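(* Let $X=(X,d,W)$ be a Hadamard space and let $f:X\to\mathbb{R}$ be a strongly quasiconvex lower semicontinuous function with value $\gamma>0$ such that $\mathrm{argmin} f\neq\emptyset$. Let $(c_k)_{k\in\mathbb{N}}$ be a sequence of nonnegative reals with $\inf_{k\in\mathbb{N}}c_k\geq c>0$. Let $x^0\in X$ be arbitrary and let $(x^k)_{k\in\mathbb{N}}$ be any sequence in $X$ starting at $x^0$ such that $x^{k+1}\in\mathrm{Prox}_{c_kf}(x^k)$ for all $k\in\mathbb{N}$. Then $(x^k)$ converges (in the metric $d$) to the unique minimizer $x^*$ of $f$, and $f(x^k)$ converges to $\min f$. Further, let $b\geq d^2(x^0,x^* )$, let $\lambda_0=\frac{1}{2}\frac{\gamma c}{1+\gamma c}$ and define \[ \varphi(\varepsilon):=\left\lceil\frac{4b}{\varepsilon^2((1-\lambda_0)\gamma c-\lambda_0)^2}\right\rceil+1 \] for $\varepsilon>0$. Then \[ \forall \varepsilon>0\ \forall k\geq \varphi(\varepsilon)\ \left(d(x^k,x^* )<\varepsilon\right) \] and \[ \forall \varepsilon>0\ \forall k\geq\varphi(\sqrt{2c\varepsilon})+1\ \left(f(x^k)-\min f<\varepsilon\right). \]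
   Context: A hyperbolic space is a triple $(X,d,W)$ where $(X,d)$ is a metric space and $W:X\times X\times[0,1]\to X$ satisfies, for all $x,y,z,w\in X$ and $\lambda,\lambda'\in[0,1]$: (W1) $d(W(x,y,\lambda),z)\leq(1-\lambda)d(x,z)+\lambda d(y,z)$; (W2) $d(W(x,y,\lambda),W(x,y,\lambda'))=|\lambda-\lambda'|d(x,y)$; (W3) $W(x,y,\lambda)=W(y,x,1-\lambda)$; (W4) $d(W(x,y,\lambda),W(z,w,\lambda))\leq(1-\lambda)d(x,z)+\lambda d(y,w)$. One writes $(1-\lambda)x\oplus\lambda y$ for $W(x,y,\lambda)$. A $\mathrm{CAT}(0)$ space is a hyperbolic space with $d^2(\frac12x\oplus\frac12y,z)\leq\frac12d^2(x,z)+\frac12d^2(y,z)-\frac14d^2(x,y)$ for all $x,y,z\in X$ (this is equivalent to the usual definition). A Hadamard space is a complete $\mathrm{CAT}(0)$ space. Here $d^2(x,y)$ denotes $(d(x,y))^2$, and $\mathbb{N}$ contains $0$. A function $f:X\to\mathbb{R}$ is strongly quasiconvex with value $\gamma>0$ if $f((1-\lambda)x\oplus\lambda y)\leq\max\{f(x),f(y)\}-\lambda(1-\lambda)\frac{\gamma}{2}d^2(x,y)$ for all $x,y\in X$ and $\lambda\in[0,1]$. It is lower semicontinuous if $\liminf_{n\to\infty}f(x_n)\geq f(x)$ whenever $x_n\to x$. $\mathrm{argmin} f$ is the set of minimizers of $f$ over $X$; for strongly quasiconvex $f$ it has at most one element. For $\beta>0$ and $x\in X$, the (possibly multi-valued)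 proximal map is $\mathrm{Prox}_{\beta f}(x):=\mathrm{argmin}_{y\in X}\{f(y)+\frac{1}{2\beta}d^2(x,y)\}$. *)

theory Defs
  imports "HOL-Analysis.Analysis"
begin

text \<open>
  The space \<open>X\<close> is a type of class \<^class>\<open>metric_space\<close> and \<open>d\<close> is \<^const>\<open>dist\<close>. The map \<open>W\<close> takes
  its parameter in \<^typ>\<open>real\<close>; only its values at parameters in \<open>{0..1}\<close> are constrained or used.
\<close>

locale hyperbolic_space =
  fixes W :: "'a::metric_space \<Rightarrow> 'a \<Rightarrow> real \<Rightarrow> 'a"
  assumes W1: "\<And>x y z l. l \<in> {0..1} \<Longrightarrow>
      dist (W x y l) z \<le> (1 - l) * dist x z + l * dist y z"
    and W2: "\<And>x y l l'. l \<in> {0..1} \<Longrightarrow> l' \<in> {0..1} \<Longrightarrow>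
      dist (W x y l) (W x y l') = \<bar>l - l'\<bar> * dist x y"
    and W3: "\<And>x y l. l \<in> {0..1} \<Longrightarrow> W x y l = W y x (1 - l)"
    and W4: "\<And>x y z w l. l \<in> {0..1} \<Longrightarrow>
      dist (W x y l) (W z w l) \<le> (1 - l) * dist x z + l * dist y w"

locale cat0_space = hyperbolic_space W for W :: "'a::metric_space \<Rightarrow> 'a \<Rightarrow> real \<Rightarrow> 'a" +
  assumes CN: "\<And>x y z.
      (dist (W x y (1/2)) z)\<^sup>2 \<le> 1/2 * (dist x z)\<^sup>2 + 1/2 * (dist y z)\<^sup>2 - 1/4 * (dist x y)\<^sup>2"

locale hadamard_space = cat0_space W for W :: "'a::metric_space \<Rightarrow> 'a \<Rightarrow> real \<Rightarrow> 'a" +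
  assumes complete_UNIV: "complete (UNIV :: 'a set)"

definition strongly_quasiconvex ::
    "('a::metric_space \<Rightarrow> 'a \<Rightarrow> real \<Rightarrow> 'a) \<Rightarrow> real \<Rightarrow> ('a \<Rightarrow> real) \<Rightarrow> bool" where
  "strongly_quasiconvex W \<gamma> f \<longleftrightarrow> \<gamma> > 0 \<and>
     (\<forall>x y. \<forall>l\<in>{0..1}.
        f (W x y l) \<le> max (f x) (f y) - l * (1 - l) * (\<gamma> / 2) * (dist x y)\<^sup>2)"

text \<open>The limes inferior is taken in \<^typ>\<open>ereal\<close>, since it may be infinite.\<close>

definition lower_semicontinuous :: "('a::metric_space \<Rightarrow> real) \<Rightarrow> bool" where
  "lower_semicontinuous f \<longleftrightarrow>
     (\<forall>x u. u \<longlonglongrightarrow> x \<longrightarrow> liminf (\<lambda>n. ereal (f (u n))) \<ge> ereal (f x))"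

definition argmin :: "('a \<Rightarrow> real) \<Rightarrow> 'a set" where
  "argmin f = {x. is_arg_min f (\<lambda>_. True) x}"

definition Prox :: "real \<Rightarrow> ('a::metric_space \<Rightarrow> real) \<Rightarrow> 'a \<Rightarrow> 'a set" where
  "Prox \<beta> f x = argmin (\<lambda>y. f y + 1 / (2 * \<beta>) * (dist x y)\<^sup>2)"

definition lambda0 :: "real \<Rightarrow> real \<Rightarrow> real" where
  "lambda0 \<gamma> c = 1/2 * (\<gamma> * c / (1 + \<gamma> * c))"

text \<open>The argument of the ceiling is nonnegative for \<open>b \<ge> 0\<close>, so \<^const>\<open>nat\<close> does not truncate then.\<close>

definition prox_rate :: "real \<Rightarrow> real \<Rightarrow> real \<Rightarrow> real \<Rightarrow> nat" where
  "prox_rate \<gamma> c b \<epsilon> =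
     nat \<lceil>4 * b / (\<epsilon>\<^sup>2 * ((1 - lambda0 \<gamma> c) * \<gamma> * c - lambda0 \<gamma> c)\<^sup>2)\<rceil> + 1"

end

theory Submission
  imports Defs
begin

text \<open>
  Let \<open>a\<close> be a minimizer of \<open>f\<close> and let \<open>p\<close> be a proximal point of \<open>x\<close> with parameter \<open>\<beta> > 0\<close>. Comparing
  \<open>p\<close> with the points \<open>W p a l\<close> of the geodesic towards \<open>a\<close>, where strong quasiconvexity bounds \<open>f\<close>
  and the CAT(0) curvature inequality bounds \<open>(dist x (W p a l))\<^sup>2\<close>, dividing by \<open>l\<close> and letting \<open>l\<close>
  tend to \<open>0\<close> gives \<open>(1 + \<gamma> * \<beta>) * (dist p a)\<^sup>2 + (dist x p)\<^sup>2 \<le> (dist x a)\<^sup>2\<close> (lemma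
  \<open>Prox_contraction\<close>). The squared distances of the proximal point iterates to \<open>a\<close> thus decay
  at least like \<open>(1 + \<gamma> * c) ^ (- k)\<close>, which an elementary growth estimate for powers
  (\<open>power_ge_quadratic\<close>) turns into the rate \<open>prox_rate\<close>. The values follow from the distances, since
  comparing \<open>p\<close> with \<open>a\<close> itself yields \<open>f p - f a \<le> (dist x a)\<^sup>2 / (2 * \<beta>)\<close>.

  The curvature inequality is assumed only at midpoints; it extends to the parameters \<open>l = 1 / 2 ^ n\<close>
  by repeated bisection, and these suffice for the limit.
\<close>

section \<open>Minimizers and proximal points\<close>

lemma mem_argmin_iff: "a \<in> argmin f \<longleftrightarrow> (\<forall>y. f a \<le> (f y :: real))"
  by (auto simp: argmin_def is_arg_min_def not_less)

lemma Prox_D: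
  assumes "p \<in> Prox \<beta> f x"
  shows "f p + (dist x p)\<^sup>2 / (2 * \<beta>) \<le> f y + (dist x y)\<^sup>2 / (2 * \<beta>)"
  using assms by (simp add: Prox_def mem_argmin_iff)

lemma Prox_value_bound:
  assumes "p \<in> Prox \<beta> f x" and "c > 0" and "c \<le> \<beta>"
  shows "f p - f a \<le> (dist x a)\<^sup>2 / (2 * c)"
proof -
  have "0 \<le> (dist x p)\<^sup>2 / (2 * \<beta>)" and "(dist x a)\<^sup>2 / (2 * \<beta>) \<le> (dist x a)\<^sup>2 / (2 * c)"
    using assms(2,3) by (auto intro: divide_left_mono)
  with Prox_D[OF assms(1), of a] show ?thesis
    by linarith
qed

section \<open>The curvature inequality at dyadic parameters\<close>

context hyperbolic_space
begin

lemma W_0: "W x y 0 = x"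
  using W1[of 0 x y x] by simp

lemma W_1: "W x y 1 = y"
  using W1[of 1 x y y] by simp

end

context cat0_space
begin

text \<open>
  The point \<open>W x y (l/2)\<close> has distance \<open>l/2 * dist x y\<close> to both \<open>x\<close> and \<open>W x y l\<close>, so the CAT(0)
  inequality forces its distance to their midpoint to vanish.
\<close>

lemma W_half_W:
  assumes "l \<in> {0..1}"
  shows "W x (W x y l) (1/2) = W x y (l/2)"
proof -
  have x: "dist x (W x y (l/2)) = l/2 * dist x y"
    using W2[of 0 "l/2" x y] assms by (simp add: W_0)
  have m: "dist (W x y l) (W x y (l/2)) = l/2 * dist x y"
    using W2[of l "l/2" x y] assms by simp
  have e: "dist x (W x y l) = l * dist x y"
    using W2[of 0 l x y] assms by (simp add: W_0)
  have "(dist (W x (W x y l) (1/2)) (W x y (l/2)))\<^sup>2 \<le> 0"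
    using CN[of x "W x y l" "W x y (l/2)"] unfolding x m e
    by (simp add: power_mult_distrib power_divide)
  then show ?thesis
    by simp
qed

lemma CN_dyadic:
  "(dist z (W x y (1 / 2 ^ n)))\<^sup>2
     \<le> (1 - 1 / 2 ^ n) * (dist z x)\<^sup>2 + 1 / 2 ^ n * (dist z y)\<^sup>2
       - 1 / 2 ^ n * (1 - 1 / 2 ^ n) * (dist x y)\<^sup>2"
proof (induction n)
  case 0
  then show ?case by (simp add: W_1)
next
  case (Suc n)
  define l :: real where "l = 1 / 2 ^ n"
  have l: "l \<in> {0..1}"
    by (auto simp: l_def)
  have l2: "1 / 2 ^ Suc n = l / 2"
    by (simp add: l_def)
  have e: "dist x (W x y l) = l * dist x y"
    using W2[of 0 l x y] l by (simp add: W_0)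
  have "(dist z (W x y (l/2)))\<^sup>2
      \<le> 1/2 * (dist z x)\<^sup>2 + 1/2 * (dist z (W x y l))\<^sup>2 - 1/4 * (l * dist x y)\<^sup>2"
    using CN[of x "W x y l" z] l by (simp add: W_half_W e dist_commute)
  also have "\<dots> \<le> 1/2 * (dist z x)\<^sup>2
      + 1/2 * ((1 - l) * (dist z x)\<^sup>2 + l * (dist z y)\<^sup>2 - l * (1 - l) * (dist x y)\<^sup>2)
      - 1/4 * (l * dist x y)\<^sup>2"
    using Suc.IH[folded l_def] by simp
  also have "\<dots> = (1 - l/2) * (dist z x)\<^sup>2 + l/2 * (dist z y)\<^sup>2
      - l/2 * (1 - l/2) * (dist x y)\<^sup>2"
    by (simp add: algebra_simps power2_eq_square)
  finally show ?case
    unfolding l2 .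
qed

end

section \<open>Contraction of the proximal map\<close>

context cat0_space
begin

lemma strongly_quasiconvex_argmin_unique:
  assumes "strongly_quasiconvex W \<gamma> f" and a: "a \<in> argmin f" and b: "b \<in> argmin f"
  shows "a = b"
proof -
  have \<gamma>: "\<gamma> > 0"
    using assms(1) by (simp add: strongly_quasiconvex_def)
  have "(1/2 :: real) \<in> {0..1}"
    by simp
  then have q: "f (W a b (1/2)) \<le> max (f a) (f b) - 1/2 * (1 - 1/2) * (\<gamma> / 2) * (dist a b)\<^sup>2"
    using assms(1) unfolding strongly_quasiconvex_def by blast
  have "f a = f b" "f a \<le> f (W a b (1/2))"
    using a b by (auto simp: mem_argmin_iff intro: antisym)
  with q have "\<gamma> * (dist a b)\<^sup>2 \<le> 0"
    by simp
  with \<gamma> show ?thesis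
    by (simp add: mult_le_0_iff)
qed

lemma Prox_contraction:
  assumes "strongly_quasiconvex W \<gamma> f" and a: "a \<in> argmin f"
    and \<beta>: "\<beta> > 0" and p: "p \<in> Prox \<beta> f x"
  shows "(1 + \<gamma> * \<beta>) * (dist p a)\<^sup>2 + (dist x p)\<^sup>2 \<le> (dist x a)\<^sup>2"
proof -
  have step: "(1 - 1 / 2 ^ n) * ((1 + \<gamma> * \<beta>) * (dist p a)\<^sup>2) + (dist x p)\<^sup>2 \<le> (dist x a)\<^sup>2" for n
  proof -
    define l :: real where "l = 1 / 2 ^ n"
    have l: "l \<in> {0..1}" and l0: "l > 0"
      by (auto simp: l_def)
    \<comment> \<open>As \<open>a\<close> is a minimizer, the quasiconvexity bound involves \<open>f p\<close> only; it cancels the \<open>f p\<close>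
      of the proximal inequality.\<close>
    have "max (f p) (f a) = f p"
      using a by (simp add: mem_argmin_iff max_absorb1)
    then have "f (W p a l) \<le> f p - l * (1 - l) * (\<gamma> / 2) * (dist p a)\<^sup>2"
      using assms(1) l by (metis strongly_quasiconvex_def)
    with Prox_D[OF p, of "W p a l"]
    have "(dist x p)\<^sup>2 / (2 * \<beta>)
        \<le> (dist x (W p a l))\<^sup>2 / (2 * \<beta>) - l * (1 - l) * (\<gamma> / 2) * (dist p a)\<^sup>2"
      by linarith
    then have "(dist x p)\<^sup>2 \<le> (dist x (W p a l))\<^sup>2 - l * (1 - l) * (\<gamma> * \<beta>) * (dist p a)\<^sup>2"
      using \<beta> by (simp add: field_simps)
    also have "\<dots> \<le> ((1 - l) * (dist x p)\<^sup>2 + l * (dist x a)\<^sup>2 - l * (1 - l) * (dist p a)\<^sup>2)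
        - l * (1 - l) * (\<gamma> * \<beta>) * (dist p a)\<^sup>2"
      using CN_dyadic[of x p a n, folded l_def] by simp
    finally have "l * ((1 - l) * ((1 + \<gamma> * \<beta>) * (dist p a)\<^sup>2) + (dist x p)\<^sup>2) \<le> l * (dist x a)\<^sup>2"
      by (simp add: algebra_simps)
    with l0 show ?thesis
      unfolding l_def[symmetric] by (simp add: mult_le_cancel_left_pos)
  qed
  have "(\<lambda>n. 1 / 2 ^ n :: real) \<longlonglongrightarrow> 0"
    using LIMSEQ_power_zero[of "1/2 :: real"] by (simp add: power_one_over)
  then have "(\<lambda>n. (1 - 1 / 2 ^ n) * ((1 + \<gamma> * \<beta>) * (dist p a)\<^sup>2) + (dist x p)\<^sup>2)
      \<longlonglongrightarrow> (1 - 0) * ((1 + \<gamma> * \<beta>) * (dist p a)\<^sup>2) + (dist x p)\<^sup>2"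
    by (intro tendsto_intros)
  then have "(1 - 0) * ((1 + \<gamma> * \<beta>) * (dist p a)\<^sup>2) + (dist x p)\<^sup>2 \<le> (dist x a)\<^sup>2"
    by (rule LIMSEQ_le_const2) (use step in blast)
  then show ?thesis
    by simp
qed

end

section \<open>The explicit rate\<close>

text \<open>
  The factor \<open>h\<^sup>2\<close> matches the squared denominator of \<open>prox_rate\<close>. Splitting off \<open>(1 + h)\<^sup>2\<close> before
  applying Bernoulli's inequality makes the bound valid for small and for large \<open>h\<close> alike.
\<close>

lemma power_ge_quadratic:
  fixes h :: real
  assumes "h \<ge> 0" and "k \<ge> 2"
  shows "(real k - 1) * h\<^sup>2 \<le> (1 + h) ^ k"
proof -
  obtain n where k: "k = n + 2"
    using assms(2) by (metis le_add_diff_inverse2)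
  have "(real k - 1) * h\<^sup>2 \<le> (1 + real n * h) * (1 + h)\<^sup>2"
    using assms(1) by (simp add: k power2_eq_square algebra_simps)
  also have "\<dots> \<le> (1 + h) ^ n * (1 + h)\<^sup>2"
    using assms(1) by (intro mult_right_mono Bernoulli_inequality) auto
  finally show ?thesis
    unfolding k power_add .
qed

text \<open>By the choice of \<open>lambda0\<close>, the term \<open>(1 - lambda0 \<gamma> c) * \<gamma> * c - lambda0 \<gamma> c\<close> is \<open>\<gamma> * c / 2\<close>.\<close>

lemma prox_rate_eq:
  assumes "\<gamma> * c > 0"
  shows "prox_rate \<gamma> c b \<epsilon> = nat \<lceil>16 * b / (\<epsilon>\<^sup>2 * (\<gamma> * c)\<^sup>2)\<rceil> + 1"
proof -
  have "(\<gamma> * c / (1 + \<gamma> * c)) * (1 + \<gamma> * c) = \<gamma> * c"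
    using assms by (intro nonzero_eq_divide_eq[THEN iffD1, OF _ refl]) linarith
  then have "lambda0 \<gamma> c * (1 + \<gamma> * c) = \<gamma> * c / 2"
    unfolding lambda0_def mult.assoc by (simp only: mult_1_left times_divide_eq_left)
  moreover have "(1 - lambda0 \<gamma> c) * \<gamma> * c - lambda0 \<gamma> c = \<gamma> * c - lambda0 \<gamma> c * (1 + \<gamma> * c)"
    by (simp add: algebra_simps)
  ultimately have eq: "(1 - lambda0 \<gamma> c) * \<gamma> * c - lambda0 \<gamma> c = \<gamma> * c / 2"
    by linarith
  show ?thesis
    unfolding prox_rate_def eq by (simp add: power_divide)
qed

lemma geometric_decay_prox_rate:
  assumes h: "\<gamma> * c > 0" and decay: "(1 + \<gamma> * c) ^ k * D\<^sup>2 \<le> b"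
    and \<epsilon>: "\<epsilon> > 0" and k: "k \<ge> prox_rate \<gamma> c b \<epsilon>"
  shows "D < \<epsilon>"
proof -
  have pos: "(1 + \<gamma> * c) ^ k > 0"
    using h by simp
  show ?thesis
  proof (cases "b > 0")
    case False
    have "(1 + \<gamma> * c) ^ k * D\<^sup>2 \<le> 0"
      using decay False by linarith
    with pos have "D = 0"
      by (simp add: mult_le_0_iff)
    with \<epsilon> show ?thesis
      by simp
  next
    case True
    define t where "t = 16 * b / (\<epsilon>\<^sup>2 * (\<gamma> * c)\<^sup>2)"
    have t: "t > 0"
      unfolding t_def using True \<epsilon> zero_less_power[OF h, of 2]
      by (intro divide_pos_pos mult_pos_pos[of "\<epsilon>\<^sup>2"]) auto
    have kt: "real k - 1 \<ge> t"
      using k real_nat_ceiling_ge[of t] unfolding prox_rate_eq[OF h] t_def[symmetric] by linarith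
    \<comment> \<open>Here the summand \<open>1\<close> of \<open>prox_rate\<close> is needed.\<close>
    with t have "k \<ge> 2"
      by linarith
    have "(1 + \<gamma> * c) ^ k * D\<^sup>2 \<le> b"
      by (rule decay)
    also have "\<dots> < 16 * b"
      using True by simp
    also have "\<dots> = \<epsilon>\<^sup>2 * (t * (\<gamma> * c)\<^sup>2)"
    proof -
      have "\<epsilon>\<^sup>2 * (\<gamma> * c)\<^sup>2 \<noteq> 0"
        using \<epsilon> h by auto
      then show ?thesis
        by (simp add: t_def mult_ac del: mult_eq_0_iff)
    qed
    also have "\<dots> \<le> \<epsilon>\<^sup>2 * ((real k - 1) * (\<gamma> * c)\<^sup>2)"
      using kt by (intro mult_left_mono mult_right_mono) auto
    also have "\<dots> \<le> \<epsilon>\<^sup>2 * (1 + \<gamma> * c) ^ k"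
      using power_ge_quadratic[of "\<gamma> * c" k] h \<open>k \<ge> 2\<close> by (intro mult_left_mono) auto
    finally have "(1 + \<gamma> * c) ^ k * D\<^sup>2 < (1 + \<gamma> * c) ^ k * \<epsilon>\<^sup>2"
      by (simp add: mult.commute)
    with pos have "D\<^sup>2 < \<epsilon>\<^sup>2"
      by (simp add: mult_less_cancel_left_pos)
    with \<epsilon> show ?thesis
      by (simp add: power_less_imp_less_base)
  qed
qed

section \<open>Convergence of the proximal point iteration\<close>

theorem theorem15:
  fixes W :: "'a::metric_space \<Rightarrow> 'a \<Rightarrow> real \<Rightarrow> 'a"
    and f :: "'a \<Rightarrow> real"
    and \<gamma> c :: real
    and cs :: "nat \<Rightarrow> real"
    and x :: "nat \<Rightarrow> 'a"
  assumes "hadamard_space W"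
    and "strongly_quasiconvex W \<gamma> f"
    and "lower_semicontinuous f"
    and "argmin f \<noteq> {}"
    and "\<And>k. cs k \<ge> 0"
    and "(INF k. cs k) \<ge> c"
    and "c > 0"
    and "\<And>k. x (Suc k) \<in> Prox (cs k) f (x k)"
  shows "\<exists>xstar. argmin f = {xstar} \<and>
    x \<longlonglongrightarrow> xstar \<and>
    (\<lambda>k. f (x k)) \<longlonglongrightarrow> f xstar \<and>
    (\<forall>b \<ge> (dist (x 0) xstar)\<^sup>2.
       (\<forall>\<epsilon>>0. \<forall>k \<ge> prox_rate \<gamma> c b \<epsilon>. dist (x k) xstar < \<epsilon>) \<and>
       (\<forall>\<epsilon>>0. \<forall>k \<ge> prox_rate \<gamma> c b (sqrt (2 * c * \<epsilon>)) + 1. f (x k) - f xstar < \<epsilon>))"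
proof -
  interpret hadamard_space W
    by (rule assms(1))
  obtain a where a: "a \<in> argmin f"
    using assms(4) by blast
  have argmin: "argmin f = {a}"
    using a strongly_quasiconvex_argmin_unique[OF assms(2)] by blast
  have "\<gamma> > 0"
    using assms(2) by (simp add: strongly_quasiconvex_def)
  then have h: "\<gamma> * c > 0"
    using assms(7) by simp
  \<comment> \<open>Nonnegativity makes the infimum over the \<open>cs k\<close> a genuine lower bound.\<close>
  have "bdd_below (range cs)"
    using assms(5) by (auto intro!: bdd_belowI)
  then have cs: "c \<le> cs k" for k
    using assms(6) by (meson cINF_lower UNIV_I order_trans)
  have contr: "(1 + \<gamma> * c) * (dist (x (Suc k)) a)\<^sup>2 \<le> (dist (x k) a)\<^sup>2" for k
  proof -
    have "(1 + \<gamma> * c) * (dist (x (Suc k)) a)\<^sup>2 \<le> (1 + \<gamma> * cs k) * (dist (x (Suc k)) a)\<^sup>2"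
      using cs[of k] \<open>\<gamma> > 0\<close> by (intro mult_right_mono) auto
    moreover have "cs k > 0"
      using cs[of k] assms(7) by linarith
    ultimately show ?thesis
      using Prox_contraction[OF assms(2) a _ assms(8)[of k]]
        zero_le_power2[of "dist (x k) (x (Suc k))"] by linarith
  qed
  have decay: "(1 + \<gamma> * c) ^ k * (dist (x k) a)\<^sup>2 \<le> (dist (x 0) a)\<^sup>2" for k
  proof (induction k)
    case (Suc k)
    have "(1 + \<gamma> * c) ^ k * ((1 + \<gamma> * c) * (dist (x (Suc k)) a)\<^sup>2)
        \<le> (1 + \<gamma> * c) ^ k * (dist (x k) a)\<^sup>2"
      using contr h by (intro mult_left_mono) auto
    with Suc show ?case
      by (simp add: mult_ac)
  qed simp
  have dist_rate: "dist (x k) a < \<epsilon>"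
    if "(dist (x 0) a)\<^sup>2 \<le> b" "\<epsilon> > 0" "k \<ge> prox_rate \<gamma> c b \<epsilon>" for b \<epsilon> k
    using geometric_decay_prox_rate[OF h order_trans[OF decay that(1)] that(2,3)] .
  have value_rate: "f (x k) - f a < \<epsilon>"
    if b: "(dist (x 0) a)\<^sup>2 \<le> b" and \<epsilon>: "\<epsilon> > 0"
      and k: "k \<ge> prox_rate \<gamma> c b (sqrt (2 * c * \<epsilon>)) + 1" for b \<epsilon> k
  proof -
    obtain j where j: "k = Suc j" "j \<ge> prox_rate \<gamma> c b (sqrt (2 * c * \<epsilon>))"
      using k by (cases k) auto
    have "dist (x j) a < sqrt (2 * c * \<epsilon>)"
      using dist_rate[OF b _ j(2)] \<epsilon> assms(7) by simp
    then have "(dist (x j) a)\<^sup>2 < 2 * c * \<epsilon>"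
      using real_sqrt_less_iff[of "(dist (x j) a)\<^sup>2" "2 * c * \<epsilon>"] by simp
    then have "(dist (x j) a)\<^sup>2 / (2 * c) < \<epsilon>"
      using assms(7) by (simp add: field_simps)
    with Prox_value_bound[OF assms(8)[of j] assms(7) cs] show ?thesis
      unfolding j(1) by (rule order.strict_trans1)
  qed
  have "x \<longlonglongrightarrow> a"
    using dist_rate[OF order_refl] by (intro metric_LIMSEQ_I) blast
  moreover have "(\<lambda>k. f (x k)) \<longlonglongrightarrow> f a"
  proof (rule metric_LIMSEQ_I)
    fix \<epsilon> :: real assume "\<epsilon> > 0"
    moreover have "f a \<le> f y" for y
      using a by (simp add: mem_argmin_iff)
    ultimately show "\<exists>N. \<forall>n\<ge>N. dist (f (x n)) (f a) < \<epsilon>"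
      using value_rate[OF order_refl] by (auto simp: dist_real_def abs_of_nonneg)
  qed
  ultimately show ?thesis
    using argmin dist_rate value_rate by blast
qed

end
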